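(* Let $\mathbb{S}\subset\mathbb{P}_m(\mathbb{C}^{n\times n})$ be either the set of Hermitian or the set of skew-Hermitian matrix polynomials, let $P\in\mathbb{S}$ be regular, and let $\epsilon>0$ (with $\infty$ not in the relevant $\epsilon$-pseudospectra of $P$). Then for $M\in\{2,F\}$ and every $\lambda\in\mathbb{R}$, $\eta_M^{\mathbb{S}}(\lambda,P)=\eta(\lambda,P)$, and $\sigma_\epsilon^{\mathbb{S}}(P)\cap\mathbb{R}=\sigma_\epsilon(P)\cap\mathbb{R}$.
   Context: $m,n\ge1$ are integers. $\mathbb{P}_m(\mathbb{C}^{n\times n})$ is the vector space of matrix polynomials $P(z)=\sum_{j=0}^m z^jA_j$, $A_j\in\mathbb{C}^{n\times n}$. $P$ is regular if $\det P(z)\not\equiv0$; Hermitian (skew-Hermitian) if all $A_j^H=A_j$ (resp. $A_j^H=-A_j$). $\sigma(P):=\{z\in\mathbb{C}:\det P(z)=0\}$. For $M\in\{2,F\}$, $|||P|||_M:=\left(\sum_{j=0}^m\|A_j\|_M^2\right)^{1/2}$ with $\|\cdot\|_F$ Frobenius and $\|\cdot\|_2$ spectral norm. For $x\in\mathbb{C}^n$ with $\|x\|_2=1$: $\eta(\lambda,x,P):=\inf\{|||\Delta P|||_M:\Delta P\in\mathbb{P}_m(\mathbb{C}^{n\times n}),\ P(\lambda)x+\Delta P(\lambda)x=0\}=\|P(\lambda)x\|_2/\|[1,\lambda,\ldots,\lambda^m]^T\|_2$ (same for $M=2,F$) and $\eta_M^{\mathbb{S}}(\lambda,x,P):=\inf\{|||\Delta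 P|||_M:\Delta P\in\mathbb{S},\ P(\lambda)x+\Delta P(\lambda)x=0\}$. Backward errors of $\lambda$: $\eta(\lambda,P):=\min_{\|x\|_2=1}\eta(\lambda,x,P)$, $\eta_M^{\mathbb{S}}(\lambda,P):=\min_{\|x\|_2=1}\eta_M^{\mathbb{S}}(\lambda,x,P)$. Pseudospectra: $\sigma_\epsilon(P):=\bigcup\{\sigma(P+\Delta P):\Delta P\in\mathbb{P}_m(\mathbb{C}^{n\times n}),\ |||\Delta P|||_M\le\epsilon\}$ (the same set for $M=2,F$) and $\sigma_\epsilon^{\mathbb{S}}(P):=\bigcup\{\sigma(P+\Delta P):\Delta P\in\mathbb{S},\ |||\Delta P|||_M\le\epsilon\}$. Only finite eigenvalues are considered; the paper assumes throughout, for simplicity, that $\infty\notin\sigma_\epsilon(P)$. *)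

theory Defs
  imports "HOL-Analysis.Analysis" "HOL-Computational_Algebra.Polynomial"
begin

(* Matrix polynomials are elements of the type ((complex^'n)^'n) poly.  The library function
   poly is not used for evaluation, because the product on that matrix type is entrywise. *)

definition matpolys :: "nat \<Rightarrow> ((complex^'n)^'n) poly set" where
  "matpolys m = {P. degree P \<le> m}"

definition meval :: "nat \<Rightarrow> ((complex^'n)^'n) poly \<Rightarrow> complex \<Rightarrow> (complex^'n)^'n" where
  "meval m P z = (\<chi> a b. \<Sum>j\<le>m. z ^ j * coeff P j $ a $ b)"

definition conj_transpose :: "(complex^'n)^'n \<Rightarrow> (complex^'n)^'n" where
  "conj_transpose A = (\<chi> a b. cnj (A $ b $ a))"

definition hermitian_matpolys :: "nat \<Rightarrow> ((complex^'n)^'n) poly set" where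
  "hermitian_matpolys m =
     {P \<in> matpolys m. \<forall>j\<le>m. conj_transpose (coeff P j) = coeff P j}"

definition skew_hermitian_matpolys :: "nat \<Rightarrow> ((complex^'n)^'n) poly set" where
  "skew_hermitian_matpolys m =
     {P \<in> matpolys m. \<forall>j\<le>m. conj_transpose (coeff P j) = - coeff P j}"

definition regular_matpoly :: "nat \<Rightarrow> ((complex^'n)^'n) poly \<Rightarrow> bool" where
  "regular_matpoly m P \<longleftrightarrow> (\<exists>z. det (meval m P z) \<noteq> 0)"

definition spectrum :: "nat \<Rightarrow> ((complex^'n)^'n) poly \<Rightarrow> complex set" where
  "spectrum m P = {z. det (meval m P z) = 0}"

(* Infinity is an eigenvalue of P iff 0 is an eigenvalue of the reversal z^m P(1/z),
   whose value at 0 is the coefficient of z^m (possibly zero) in P. *)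
definition infinite_eigenvalue :: "nat \<Rightarrow> ((complex^'n)^'n) poly \<Rightarrow> bool" where
  "infinite_eigenvalue m P \<longleftrightarrow> det (coeff P m) = 0"

definition spectral_norm :: "(complex^'n)^'n \<Rightarrow> real" where
  "spectral_norm A = onorm (\<lambda>x. A *v x)"

definition frobenius_norm :: "(complex^'n)^'n \<Rightarrow> real" where
  "frobenius_norm A = sqrt (\<Sum>a\<in>UNIV. \<Sum>b\<in>UNIV. (cmod (A $ a $ b))\<^sup>2)"

(* Below, M is the norm applied to the coefficients, and S the set of admissible perturbations;
   S = matpolys m gives the unstructured notions. *)

definition matpoly_norm ::
    "((complex^'n)^'n \<Rightarrow> real) \<Rightarrow> nat \<Rightarrow> ((complex^'n)^'n) poly \<Rightarrow> real" where
  "matpoly_norm M m P = sqrt (\<Sum>j\<le>m. (M (coeff P j))\<^sup>2)"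

(* The set of admissible D is nonempty whenever - P lies in S. *)
definition backward_error_at ::
    "((complex^'n)^'n \<Rightarrow> real) \<Rightarrow> nat \<Rightarrow> ((complex^'n)^'n) poly set \<Rightarrow>
     complex \<Rightarrow> complex^'n \<Rightarrow> ((complex^'n)^'n) poly \<Rightarrow> real" where
  "backward_error_at M m S z x P =
     Inf {matpoly_norm M m D | D. D \<in> S \<and> meval m P z *v x + meval m D z *v x = 0}"

(* This infimum is a minimum, see backward_error_attained. *)
definition backward_error ::
    "((complex^'n)^'n \<Rightarrow> real) \<Rightarrow> nat \<Rightarrow> ((complex^'n)^'n) poly set \<Rightarrow>
     complex \<Rightarrow> ((complex^'n)^'n) poly \<Rightarrow> real" where
  "backward_error M m S z P = (INF x\<in>{x. norm x = 1}. backward_error_at M m S z x P)"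

definition pseudospectrum ::
    "((complex^'n)^'n \<Rightarrow> real) \<Rightarrow> nat \<Rightarrow> ((complex^'n)^'n) poly set \<Rightarrow>
     real \<Rightarrow> ((complex^'n)^'n) poly \<Rightarrow> complex set" where
  "pseudospectrum M m S \<epsilon> P = (\<Union>D\<in>{D \<in> S. matpoly_norm M m D \<le> \<epsilon>}. spectrum m (P + D))"

definition infinity_in_pseudospectrum ::
    "((complex^'n)^'n \<Rightarrow> real) \<Rightarrow> nat \<Rightarrow> ((complex^'n)^'n) poly set \<Rightarrow>
     real \<Rightarrow> ((complex^'n)^'n) poly \<Rightarrow> bool" where
  "infinity_in_pseudospectrum M m S \<epsilon> P \<longleftrightarrow>
     (\<exists>D\<in>S. matpoly_norm M m D \<le> \<epsilon> \<and> infinite_eigenvalue m (P + D))"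

lemma frobenius_norm_eq_norm: "frobenius_norm A = norm A"
  by (simp add: frobenius_norm_def norm_vec_def L2_set_def sum_nonneg)

lemma coeff_norm_facts:
  fixes M :: "(complex^'n)^'n \<Rightarrow> real"
  assumes "M \<in> {spectral_norm, frobenius_norm}"
  shows "continuous_on UNIV M" and "M A \<ge> 0" and "norm A \<le> real CARD('n) * real CARD('n) * M A"
proof -
  have bl: "bounded_linear (\<lambda>x. B *v x)" for B :: "(complex^'n)^'n"
    by (intro linear_conv_bounded_linear[THEN iffD1] linearI)
       (auto simp: matrix_vector_mult_def vec_eq_iff algebra_simps sum.distrib scaleR_sum_right)
  have tri: "spectral_norm (B + C) \<le> spectral_norm B + spectral_norm C" for B C :: "(complex^'n)^'n"
  proof -
    have "(\<lambda>x. (B + C) *v x) = (\<lambda>x. B *v x + C *v x)"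
      by (simp add: fun_eq_iff matrix_vector_mult_add_rdistrib)
    then show ?thesis unfolding spectral_norm_def using onorm_triangle[OF bl bl, of B C] by simp
  qed
  have scl: "spectral_norm (r *\<^sub>R B) = \<bar>r\<bar> * spectral_norm B" for r and B :: "(complex^'n)^'n"
  proof -
    have "(\<lambda>x. (r *\<^sub>R B) *v x) = (\<lambda>x. r *\<^sub>R (B *v x))"
      by (auto simp: fun_eq_iff matrix_vector_mult_def vec_eq_iff scaleR_sum_right)
    then show ?thesis unfolding spectral_norm_def using onorm_scaleR[OF bl, of r B] by simp
  qed
  have "convex_on UNIV (spectral_norm :: (complex^'n)^'n \<Rightarrow> real)"
  proof (rule convex_onI)
    fix t :: real and x y :: "(complex^'n)^'n" assume "0 < t" "t < 1"
    then show "spectral_norm ((1 - t) *\<^sub>R x + t *\<^sub>R y)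
        \<le> (1 - t) * spectral_norm x + t * spectral_norm y"
      using tri[of "(1 - t) *\<^sub>R x" "t *\<^sub>R y"] by (simp add: scl)
  qed simp
  then have "continuous_on UNIV (spectral_norm :: (complex^'n)^'n \<Rightarrow> real)"
    by (intro convex_on_continuous) auto
  moreover have fr: "(frobenius_norm :: (complex^'n)^'n \<Rightarrow> real) = norm"
    by (auto simp: frobenius_norm_eq_norm)
  ultimately show "continuous_on UNIV M"
    using assms by (auto intro: continuous_intros)
  show "M A \<ge> 0"
    using assms by (auto simp: spectral_norm_def fr onorm_pos_le[OF bl])
  have ent: "cmod (A $ a $ b) \<le> M A" for a b
  proof -
    have "cmod (A $ a $ b) = cmod ((A *v axis b 1) $ a)"
      by (simp add: matrix_vector_mult_def axis_def if_distrib cong: if_cong)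
    also have "\<dots> \<le> norm (A *v axis b 1)" by (rule Finite_Cartesian_Product.norm_nth_le)
    also have "\<dots> \<le> onorm (\<lambda>x. A *v x) * norm (axis b 1 :: complex^'n)" by (rule onorm[OF bl])
    finally have "cmod (A $ a $ b) \<le> spectral_norm A" by (simp add: spectral_norm_def norm_axis_1)
    moreover have "cmod (A $ a $ b) \<le> norm A"
      using Finite_Cartesian_Product.norm_nth_le[of A a]
        Finite_Cartesian_Product.norm_nth_le[of "A $ a" b] by linarith
    ultimately show ?thesis using assms by (auto simp: fr)
  qed
  have "norm A \<le> (\<Sum>a\<in>UNIV. norm (A $ a))" by (simp add: norm_vec_def L2_set_le_sum)
  also have "\<dots> \<le> (\<Sum>a\<in>UNIV. \<Sum>b\<in>UNIV. cmod (A $ a $ b))"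
    by (intro sum_mono) (simp add: norm_vec_def L2_set_le_sum)
  also have "\<dots> \<le> (\<Sum>a::'n\<in>UNIV. \<Sum>b::'n\<in>UNIV. M A)" by (intro sum_mono ent)
  finally show "norm A \<le> real CARD('n) * real CARD('n) * M A" by simp
qed

lemma backward_error_attained:
  fixes P :: "((complex^'n)^'n) poly"
  assumes M: "M \<in> {spectral_norm, frobenius_norm}"
    and S: "S \<in> {matpolys m, hermitian_matpolys m, skew_hermitian_matpolys m}"
    and P: "P \<in> S"
  shows "\<exists>x. norm x = 1 \<and> backward_error M m S z P = backward_error_at M m S z x P"
proof -
  define C where "C = real CARD('n) * real CARD('n) * matpoly_norm M m P"
  define Q :: "((complex^'n)^'n) set" where "Q = (if S = matpolys m then UNIV else
     if S = hermitian_matpolys m then {A. conj_transpose A = A} else {A. conj_transpose A = - A})"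
  define K where "K = Pi\<^sub>E UNIV (\<lambda>j. if j \<le> m then cball 0 C \<inter> Q else {0::(complex^'n)^'n})"
  define g where "g D = sqrt (\<Sum>j\<le>m. (M (D j))\<^sup>2)" for D :: "nat \<Rightarrow> (complex^'n)^'n"
  define ev where "ev D x = (\<chi> a. \<Sum>b\<in>UNIV. (\<Sum>j\<le>m. z ^ j * D j $ a $ b) * x $ b)"
    for D :: "nat \<Rightarrow> (complex^'n)^'n" and x :: "complex^'n"
  define F where "F = (sphere (0::complex^'n) 1 \<times> K) \<inter>
     {w. ev (coeff P) (fst w) + ev (snd w) (fst w) = 0}"
  note Mf = coeff_norm_facts[OF M]
  have ct: "continuous_on UNIV (conj_transpose :: (complex^'n)^'n \<Rightarrow> _)"
    unfolding conj_transpose_def by (intro continuous_intros)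
  have "closed Q"
  proof -
    have "closed {A :: (complex^'n)^'n. conj_transpose A = A}"
      by (rule closed_Collect_eq[OF ct continuous_on_id])
    moreover have "closed {A :: (complex^'n)^'n. conj_transpose A = - A}"
      by (rule closed_Collect_eq[OF ct continuous_on_minus[OF continuous_on_id]])
    ultimately show ?thesis by (simp add: Q_def)
  qed
  then have "compactin (product_topology (\<lambda>_. euclidean) UNIV) K"
    unfolding K_def compactin_PiE by auto
  then have "compact K" by (simp add: euclidean_product_topology)
  have ev_eq: "meval m D z *v x = ev (coeff D) x" for D x
    by (simp add: ev_def meval_def matrix_vector_mult_def)
  have "compact (sphere (0::complex^'n) 1 \<times> K)" by (intro compact_Times \<open>compact K\<close> compact_sphere)
  moreover have "closed {w. ev (coeff P) (fst w) + ev (snd w) (fst w) = 0}"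
  proof (rule closed_Collect_eq)
    have co: "continuous_on UNIV (\<lambda>w::(complex^'n) \<times> (nat \<Rightarrow> (complex^'n)^'n). snd w j)" for j
      by (rule continuous_on_product_then_coordinatewise[OF continuous_on_snd[OF continuous_on_id]])
    show "continuous_on UNIV (\<lambda>w. ev (coeff P) (fst w) + ev (snd w) (fst w))"
      unfolding ev_def
      by (intro continuous_on_add continuous_on_vec_lambda continuous_on_sum continuous_on_mult
            continuous_on_const continuous_on_component continuous_on_fst continuous_on_id co)
  qed simp
  ultimately have "compact (F)" unfolding F_def by (rule compact_Int_closed)
  have SQ: "D \<in> S \<longleftrightarrow> degree D \<le> m \<and> (\<forall>j\<le>m. coeff D j \<in> Q)" for D
    using S by (auto simp: Q_def matpolys_def hermitian_matpolys_def skew_hermitian_matpolys_def)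
  have cr: "coeff D \<in> K" if "D \<in> S" "matpoly_norm M m D \<le> matpoly_norm M m P" for D
  proof -
    have "norm (coeff D j) \<le> C" if "j \<le> m" for j
    proof -
      have "M (coeff D j) = sqrt ((M (coeff D j))\<^sup>2)" using Mf(2) by simp
      also have "\<dots> \<le> matpoly_norm M m D"
        unfolding matpoly_norm_def using that by (intro real_sqrt_le_mono member_le_sum) auto
      finally have "M (coeff D j) \<le> matpoly_norm M m P"
        using \<open>matpoly_norm M m D \<le> matpoly_norm M m P\<close> by simp
      then have "real CARD('n) * real CARD('n) * M (coeff D j) \<le> C"
        unfolding C_def by (intro mult_left_mono) auto
      with Mf(3)[of "coeff D j"] show ?thesis by linarith
    qed
    then show ?thesis using that by (auto simp: K_def PiE_iff SQ coeff_eq_0)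
  qed
  have kr: "\<exists>D. D \<in> S \<and> coeff D = c" if "c \<in> K" for c
  proof -
    have cK: "c i \<in> (if i \<le> m then cball 0 C \<inter> Q else {0})" for i
      using that unfolding K_def by (rule PiE_mem) simp
    have c0: "c i = 0" if "i > m" for i using cK[of i] that by simp
    have cA: "coeff (Abs_poly c) = c" using coeff_Abs_poly[of m c] c0 by blast
    have "degree (Abs_poly c) \<le> m" using c0 by (intro degree_le) (simp add: cA)
    moreover have "c j \<in> Q" if "j \<le> m" for j using cK[of j] that by simp
    ultimately show ?thesis using cA by (intro exI[of _ "Abs_poly c"]) (simp add: SQ)
  qed
  have ct_neg: "conj_transpose (- A) = - conj_transpose A" for A :: "(complex^'n)^'n"
    by (simp add: conj_transpose_def vec_eq_iff)
  have negQ: "- A \<in> Q" if "A \<in> Q" for A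
    using that by (auto simp: Q_def ct_neg split: if_splits)
  have mP: "- P \<in> S" using P by (auto simp: SQ intro: negQ)
  have M_neg: "M (- A) = M A" for A
  proof -
    have "(\<lambda>x. - A *v x) = (\<lambda>x. - (A *v x))"
      by (auto simp: fun_eq_iff matrix_vector_mult_def vec_eq_iff sum_negf)
    then have "spectral_norm (- A) = spectral_norm A"
      by (simp add: spectral_norm_def onorm_neg)
    then show ?thesis using M by (auto simp: frobenius_norm_def)
  qed
  have nP: "matpoly_norm M m (- P) = matpoly_norm M m P" by (simp add: matpoly_norm_def M_neg)
  have fP: "ev (coeff P) x + ev (coeff (- P)) x = 0" for x
    by (simp add: ev_def vec_eq_iff sum_negf)
  obtain e :: "complex^'n" where e: "norm e = 1" using vector_choose_size[of 1] by auto
  have "(e, coeff (- P)) \<in> F" using cr[OF mP] nP fP e by (auto simp: F_def)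
  then have "F \<noteq> {}" by blast
  moreover have "continuous_on (F) (\<lambda>w. g (snd w))"
  proof -
    have "continuous_on F (\<lambda>w. M (snd w j))" for j
      by (rule continuous_on_compose2[OF Mf(1) continuous_on_product_then_coordinatewise])
         (auto intro: continuous_on_snd continuous_on_id)
    then show ?thesis
      unfolding g_def by (intro continuous_on_real_sqrt continuous_on_sum continuous_on_power)
  qed
  ultimately obtain w where w: "w \<in> F" and wmin: "\<And>v. v \<in> F \<Longrightarrow> g (snd w) \<le> g (snd v)"
    using continuous_attains_inf[OF \<open>compact (F)\<close>] by blast
  obtain D where D: "D \<in> S" "coeff D = snd w" using kr[of "snd w"] w by (auto simp: F_def)
  have gD: "matpoly_norm M m D = g (snd w)" using D by (simp add: matpoly_norm_def g_def)
  have low: "g (snd w) \<le> matpoly_norm M m E"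
    if "E \<in> S" "norm x = 1" "meval m P z *v x + meval m E z *v x = 0" for E x
  proof (cases "matpoly_norm M m E \<le> matpoly_norm M m P")
    case True
    then have "(x, coeff E) \<in> F" using that cr by (auto simp: F_def ev_eq)
    then show ?thesis using wmin by (fastforce simp: matpoly_norm_def g_def)
  next
    case False
    have "g (snd w) \<le> g (coeff (- P))" using wmin \<open>(e, coeff (- P)) \<in> F\<close> by fastforce
    then show ?thesis using False nP by (simp add: matpoly_norm_def g_def)
  qed
  let ?B = "\<lambda>x. {matpoly_norm M m D | D. D \<in> S \<and> meval m P z *v x + meval m D z *v x = 0}"
  have ge: "g (snd w) \<le> backward_error_at M m S z x P" if "norm x = 1" for x
    unfolding backward_error_at_def
    using mP fP low that by (intro cInf_greatest) (auto simp: ev_eq)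
  have nw: "norm (fst w) = 1" and Dw: "meval m P z *v fst w + meval m D z *v fst w = 0"
    using w D by (auto simp: F_def ev_eq)
  have "backward_error_at M m S z (fst w) P \<le> matpoly_norm M m D"
    unfolding backward_error_at_def
    using low[OF _ nw] D(1) Dw by (intro cInf_lower bdd_belowI[of _ "g (snd w)"]) auto
  then have eqw: "backward_error_at M m S z (fst w) P = g (snd w)" using ge[OF nw] gD by simp
  have "backward_error M m S z P = g (snd w)"
    unfolding backward_error_def
  proof (rule antisym)
    show "(INF x\<in>{x. norm x = 1}. backward_error_at M m S z x P) \<le> g (snd w)"
      unfolding eqw[symmetric] using nw ge
      by (intro cINF_lower) (auto intro!: bdd_belowI[of _ "g (snd w)"])
    show "g (snd w) \<le> (INF x\<in>{x. norm x = 1}. backward_error_at M m S z x P)"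
      using nw ge by (intro cINF_greatest) auto
  qed
  then show ?thesis using nw eqw by auto
qed

end

theory Submission
  imports Defs
begin

text \<open>For real \<open>z\<close> the matrix \<open>H = P(z)\<close> is (skew-)Hermitian. Hence the minimum \<open>s\<close> of \<open>\<parallel>H x\<parallel>\<close> over
unit vectors is attained at an eigenvector \<open>y\<close>, with \<open>H y = \<mu> y\<close> and \<open>\<bar>\<mu>\<bar> = s\<close>. With
\<open>L\<^sup>2 = \<Sum> \<bar>z\<bar>\<^sup>2\<^sup>j\<close>, the perturbation with coefficients \<open>- (z\<^sup>j / L\<^sup>2) \<mu> y y\<^sup>H\<close> has the same
structure as \<open>P\<close>, makes \<open>y\<close> a null vector, and has norm \<open>s / L\<close>. By Cauchy-Schwarz no
perturbation, structured or not, that makes \<open>P(z)\<close> singular can be smaller. So all backward errors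
are \<open>s / L\<close>, and \<open>z\<close> is in any of the \<open>\<epsilon>\<close>-pseudospectra iff \<open>s \<le> L * \<epsilon>\<close>.\<close>

section \<open>Matrix norms\<close>

lemma norm_vector_scalar_mult:
  fixes x :: "'a::real_normed_field^'n"
  shows "norm (c *s x) = norm c * norm x"
  by (simp add: norm_vec_def norm_mult L2_set_right_distrib)

text \<open>Cauchy-Schwarz in each row. The norm of the nested vector type is the Frobenius norm,
  which is thereby seen to dominate the spectral norm.\<close>

lemma norm_matrix_vector_mult_le:
  fixes A :: "'a::real_normed_field^'n^'m"
  shows "norm (A *v x) \<le> norm A * norm x"
proof -
  have "norm ((A *v x) $ a) \<le> norm (A $ a) * norm x" for a
  proof -
    have "norm ((A *v x) $ a) \<le> (\<Sum>b\<in>UNIV. norm (A $ a $ b) * norm (x $ b))"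
      unfolding matrix_vector_mult_def by (auto intro!: order_trans[OF norm_sum] simp: norm_mult)
    also have "\<dots> \<le> norm (A $ a) * norm x"
      unfolding norm_vec_def
      using L2_set_mult_ineq[of "\<lambda>b. norm (A $ a $ b)" "\<lambda>b. norm (x $ b)" UNIV] by simp
    finally show ?thesis .
  qed
  then have "norm (A *v x) \<le> L2_set (\<lambda>a. norm (A $ a) * norm x) UNIV"
    unfolding norm_vec_def[of "A *v x"] by (intro L2_set_mono) auto
  also have "\<dots> = norm A * norm x"
    by (simp add: norm_vec_def[of A] L2_set_left_distrib)
  finally show ?thesis .
qed

lemma norm_le_spectral_norm: "norm (A *v x) \<le> spectral_norm A * norm x"
  unfolding spectral_norm_def by (rule onorm) simp

lemma spectral_norm_le_norm: "spectral_norm A \<le> norm A"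
  unfolding spectral_norm_def by (rule onorm_le) (rule norm_matrix_vector_mult_le)

lemma norm_mult_le_matrix_norm:
  assumes "M \<in> {spectral_norm, frobenius_norm}"
  shows "norm (A *v x) \<le> M A * norm x"
  using assms norm_le_spectral_norm[of A x] norm_matrix_vector_mult_le[of A x]
  by (auto simp: frobenius_norm_eq_norm)

section \<open>Rank-one matrices \<open>c y y^H\<close>\<close>

definition outer_square :: "complex \<Rightarrow> complex^'n \<Rightarrow> (complex^'n)^'n" where
  "outer_square c y = (\<chi> a b. c * y $ a * cnj (y $ b))"

lemma sum_cmod_sq: "(\<Sum>b\<in>UNIV. (cmod (y $ b))\<^sup>2) = (norm y)\<^sup>2"
  by (simp add: norm_vec_def L2_set_def sum_nonneg)

lemma outer_square_mult_self:
  assumes "norm y = 1"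
  shows "outer_square c y *v y = c *s y"
proof -
  have "(\<Sum>b\<in>UNIV. cnj (y $ b) * y $ b) = of_real (\<Sum>b\<in>UNIV. (cmod (y $ b))\<^sup>2)"
    by (simp add: complex_norm_square mult.commute del: of_real_power)
  then have one: "(\<Sum>b\<in>UNIV. cnj (y $ b) * y $ b) = 1"
    unfolding sum_cmod_sq using assms by simp
  have "(outer_square c y *v y) $ a = c * y $ a * (\<Sum>b\<in>UNIV. cnj (y $ b) * y $ b)" for a
    by (simp add: outer_square_def matrix_vector_mult_def sum_distrib_left mult.assoc)
  then show ?thesis by (simp add: one vec_eq_iff)
qed

lemma norm_outer_square:
  assumes "norm y = 1"
  shows "norm (outer_square c y) = cmod c"
proof -
  have "(norm (outer_square c y))\<^sup>2 = (\<Sum>a\<in>UNIV. \<Sum>b\<in>UNIV. (cmod (outer_square c y $ a $ b))\<^sup>2)"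
    unfolding frobenius_norm_eq_norm[symmetric] frobenius_norm_def by (simp add: sum_nonneg)
  also have "\<dots> = (\<Sum>a\<in>UNIV. \<Sum>b\<in>UNIV. (cmod c)\<^sup>2 * (cmod (y $ a))\<^sup>2 * (cmod (y $ b))\<^sup>2)"
    by (simp add: outer_square_def norm_mult power_mult_distrib)
  also have "\<dots> = (cmod c)\<^sup>2 * (norm y)\<^sup>2 * (norm y)\<^sup>2"
    by (simp add: sum_cmod_sq flip: sum_distrib_left sum_distrib_right)
  finally show ?thesis using assms by simp
qed

text \<open>Both norms agree here: the unit vector \<open>y\<close> is stretched by
  \<open>cmod c\<close>, which bounds the spectral norm from below, and the Frobenius norm bounds it
  from above by the same value.\<close>

lemma matrix_norm_outer_square:
  assumes "M \<in> {spectral_norm, frobenius_norm}" and y: "norm y = 1"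
  shows "M (outer_square c y) = cmod c"
proof -
  have "cmod c \<le> spectral_norm (outer_square c y)"
    using norm_le_spectral_norm[of "outer_square c y" y] y
    by (simp add: outer_square_mult_self norm_vector_scalar_mult)
  with spectral_norm_le_norm[of "outer_square c y"] have "spectral_norm (outer_square c y) = cmod c"
    by (simp add: norm_outer_square y)
  then show ?thesis using assms(1) by (auto simp: frobenius_norm_eq_norm norm_outer_square y)
qed

lemma conj_transpose_outer_square: "conj_transpose (outer_square c y) = outer_square (cnj c) y"
  by (simp add: conj_transpose_def outer_square_def vec_eq_iff mult_ac)

section \<open>Minimal residuals of structured matrices\<close>

text \<open>First-order condition: the quadratic has a minimum at \<open>t = 0\<close>, so its slope
  there vanishes.\<close>

lemma linear_coeff_zero:
  fixes b c :: real
  assumes "\<And>t. 0 \<le> t * b + t\<^sup>2 * c"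
  shows "b = 0"
proof (rule ccontr)
  assume "b \<noteq> 0"
  have c: "c \<ge> 0" using assms[of 1] assms[of "-1"] by simp
  \<comment> \<open>Dividing by \<open>1 + c\<close> instead of \<open>c\<close> also covers
    \<open>c = 0\<close> and still gives a negative value.\<close>
  have "(- b / (1 + c)) * b + (- b / (1 + c))\<^sup>2 * c = - (b / (1 + c))\<^sup>2"
    using c by (simp add: divide_simps power2_eq_square) (simp add: algebra_simps)
  moreover have "(b / (1 + c))\<^sup>2 > 0" using \<open>b \<noteq> 0\<close> c by simp
  ultimately show False using assms[of "- b / (1 + c)"] by linarith
qed

lemma norm_add_scaleR_sq:
  fixes u w :: "'a::real_inner"
  shows "(norm (u + t *\<^sub>R w))\<^sup>2 = (norm u)\<^sup>2 + 2 * t * inner u w + t\<^sup>2 * (norm w)\<^sup>2"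
  unfolding power2_norm_eq_inner
  by (simp add: inner_add_left inner_add_right inner_commute[of w u] power2_eq_square algebra_simps)

text \<open>The nonnegative function \<open>(norm (T v))^2 - s^2 * (norm v)^2\<close> vanishes at
  \<open>x\<close>, so its derivative there is zero in every direction \<open>v\<close>.\<close>

lemma minimal_residual_inner:
  fixes T :: "'a::real_inner \<Rightarrow> 'b::real_inner"
  assumes lin: "linear T" and min: "\<And>v. s * norm v \<le> norm (T v)" and "s \<ge> 0"
    and x: "norm (T x) = s * norm x"
  shows "inner (T x) (T v) = s\<^sup>2 * inner x v"
proof -
  have "0 \<le> t * (2 * (inner (T x) (T v) - s\<^sup>2 * inner x v))
      + t\<^sup>2 * ((norm (T v))\<^sup>2 - s\<^sup>2 * (norm v)\<^sup>2)" for t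
  proof -
    have "(s * norm (x + t *\<^sub>R v))\<^sup>2 \<le> (norm (T (x + t *\<^sub>R v)))\<^sup>2"
      using min \<open>s \<ge> 0\<close> by (intro power_mono) auto
    moreover have "T (x + t *\<^sub>R v) = T x + t *\<^sub>R T v"
      using lin by (simp add: linear_add linear_scale)
    ultimately show ?thesis using x by (simp add: norm_add_scaleR_sq power_mult_distrib algebra_simps)
  qed
  from linear_coeff_zero[OF this] show ?thesis by simp
qed

text \<open>\<open>inner\<close> is the real part of the Hermitian form, and the conjugate transpose
  is the adjoint for it as well.\<close>

lemma inner_conj_transpose:
  "inner (A *v x) y = inner x (conj_transpose A *v y)"
proof -
  have t: "inner (h * u) w = inner u (cnj h * w)" for h u w :: complex
    by (simp add: inner_complex_def algebra_simps)
  have "inner (A *v x) y = (\<Sum>a\<in>UNIV. \<Sum>b\<in>UNIV. inner (x $ b) (cnj (A $ a $ b) * y $ a))"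
    by (simp add: inner_vec_def matrix_vector_mult_def inner_sum_left t)
  also have "\<dots> = (\<Sum>b\<in>UNIV. \<Sum>a\<in>UNIV. inner (x $ b) (cnj (A $ a $ b) * y $ a))"
    by (rule sum.swap)
  also have "\<dots> = inner x (conj_transpose A *v y)"
    by (simp add: inner_vec_def matrix_vector_mult_def inner_sum_right conj_transpose_def)
  finally show ?thesis .
qed

text \<open>Compactness of the unit sphere gives the minimizer; homogeneity extends the bound to all
  \<open>v\<close>.\<close>

lemma minimal_residual_attained:
  fixes A :: "(complex^'n)^'n"
  obtains x where "norm x = 1" "\<And>v. norm (A *v x) * norm v \<le> norm (A *v v)"
proof -
  obtain e :: "complex^'n" where "norm e = 1" using vector_choose_size[of 1] by auto
  then have "sphere (0::complex^'n) 1 \<noteq> {}" by auto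
  moreover have "continuous_on (sphere 0 1) (\<lambda>x. norm (A *v x))"
    by (intro continuous_on_norm linear_continuous_on) simp
  ultimately obtain x where x: "norm x = 1" "\<And>v. norm v = 1 \<Longrightarrow> norm (A *v x) \<le> norm (A *v v)"
    using continuous_attains_inf[OF compact_sphere, of "0::complex^'n" 1 "\<lambda>x. norm (A *v x)"]
    by auto
  have "norm (A *v x) * norm v \<le> norm (A *v v)" for v
  proof (cases "v = 0")
    case False
    have "bounded_linear ((*v) A)" by simp
    then have "A *v (v /\<^sub>R norm v) = (A *v v) /\<^sub>R norm v"
      by (simp add: bounded_linear.linear linear_scale)
    with x(2)[of "v /\<^sub>R norm v"] False show ?thesis by (simp add: field_simps)
  qed simp
  with x(1) that show thesis by blast
qed

text \<open>The sign \<open>\<sigma>\<close> treats Hermitian and skew-Hermitian matrices together. At a minimizer \<open>x\<close> one has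
\<open>H\<^sup>2 x = \<sigma> s\<^sup>2 x\<close>, and this factors as \<open>(H - \<omega> s) (H + \<omega> s) x = 0\<close>.\<close>

lemma minimal_residual_eigenvector:
  fixes H :: "(complex^'n)^'n" and \<sigma> :: real
  assumes sg: "\<sigma> \<in> {1, -1}" and H: "conj_transpose H = \<sigma> *\<^sub>R H"
  obtains y and \<mu> :: complex where "norm y = 1" "H *v y = \<mu> *s y" "cnj \<mu> = \<sigma> * \<mu>"
    "\<forall>v. cmod \<mu> * norm v \<le> norm (H *v v)"
proof -
  obtain x where x: "norm x = 1" and min: "\<And>v. norm (H *v x) * norm v \<le> norm (H *v v)"
    using minimal_residual_attained[of H] by blast
  define s where "s = norm (H *v x)"
  \<comment> \<open>\<open>\<omega>\<close> is a square root of \<open>\<sigma>\<close>: 1 in the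
    Hermitian case, \<open>\<i>\<close> in the skew-Hermitian one. The condition on
    \<open>cnj \<omega>\<close> passes to the eigenvalues \<open>\<omega> * s\<close> and
    \<open>- \<omega> * s\<close>.\<close>
  obtain \<omega> :: complex where om: "\<omega>\<^sup>2 = \<sigma>" "cnj \<omega> = \<sigma> * \<omega>" "cmod \<omega> = 1"
  proof (cases "\<sigma> = 1")
    case True
    then show thesis using that[of 1] by simp
  next
    case False
    then show thesis using that[of \<i>] sg by simp
  qed
  have scl: "(\<sigma> *\<^sub>R H) *v v = \<sigma> *\<^sub>R (H *v v)" for v
    by (simp add: matrix_vector_mult_def vec_eq_iff scaleR_sum_right)
  have "inner v (conj_transpose H *v (H *v x) - s\<^sup>2 *\<^sub>R x) = 0" for v
  proof -
    have "inner (H *v x) (H *v v) = s\<^sup>2 * inner x v"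
      by (rule minimal_residual_inner) (use min x in \<open>auto simp: s_def bounded_linear.linear\<close>)
    moreover have "inner v (conj_transpose H *v (H *v x)) = inner (H *v x) (H *v v)"
      unfolding inner_conj_transpose[symmetric] by (rule inner_commute)
    ultimately show ?thesis by (simp add: inner_diff_right inner_commute[of v x])
  qed
  then have "conj_transpose H *v (H *v x) = s\<^sup>2 *\<^sub>R x"
    using inner_eq_zero_iff by (metis eq_iff_diff_eq_0)
  then have "\<sigma> *\<^sub>R (H *v (H *v x)) = s\<^sup>2 *\<^sub>R x" by (simp add: H scl)
  \<comment> \<open>A second factor \<open>\<sigma>\<close> cancels the first, since
    \<open>\<sigma>^2 = 1\<close>.\<close>
  then have "\<sigma> *\<^sub>R (\<sigma> *\<^sub>R (H *v (H *v x))) = \<sigma> *\<^sub>R (s\<^sup>2 *\<^sub>R x)" by simp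
  then have "H *v (H *v x) = \<sigma> *\<^sub>R (s\<^sup>2 *\<^sub>R x)" using sg by auto
  moreover have "\<omega> * s * (\<omega> * s * c) = \<sigma> *\<^sub>R (s\<^sup>2 *\<^sub>R c)" for c
    unfolding scaleR_conv_of_real om(1)[symmetric] by (simp add: power2_eq_square mult_ac)
  ultimately have HH: "H *v (H *v x) = (\<omega> * s) *s ((\<omega> * s) *s x)"
    by (simp add: vec_eq_iff mult.assoc)
  have bound: "cmod (k * s) * norm v \<le> norm (H *v v)" if "cmod k = 1" for k v
    using min that by (simp add: norm_mult s_def)
  \<comment> \<open>If \<open>w = 0\<close>, then \<open>x\<close> is an eigenvector for
    \<open>- \<omega> * s\<close>; otherwise \<open>w\<close> is one for \<open>\<omega> * s\<close>
    and only needs normalizing.\<close>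
  define w where "w = H *v x + (\<omega> * s) *s x"
  show thesis
  proof (cases "w = 0")
    case True
    then have "H *v x = (- \<omega> * s) *s x"
      by (simp add: w_def vec_eq_iff eq_neg_iff_add_eq_0)
    then show thesis using that[of x "- \<omega> * s"] x om bound[of "- \<omega>"] by simp
  next
    case False
    define y where "y = complex_of_real (inverse (norm w)) *s w"
    have "H *v w = (\<omega> * s) *s w"
      by (simp add: w_def matrix_vector_right_distrib vector_scalar_commute HH
          vector_add_ldistrib add.commute)
    then have "H *v y = (\<omega> * s) *s y"
      by (simp add: y_def vector_scalar_commute vec_eq_iff mult_ac)
    moreover have "norm y = 1"
      using False by (simp add: y_def norm_vector_scalar_mult norm_inverse)
    ultimately show thesis using that[of y "\<omega> * s"] om bound[of \<omega>] by simp
  qed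
qed

section \<open>Matrix polynomials\<close>

lemma meval_mult_vec: "meval m P z *v x = (\<Sum>j\<le>m. z ^ j *s (coeff P j *v x))"
proof -
  have "(meval m P z *v x) $ a = (\<Sum>j\<le>m. z ^ j *s (coeff P j *v x)) $ a" for a
  proof -
    have "(meval m P z *v x) $ a = (\<Sum>b\<in>UNIV. \<Sum>j\<le>m. z ^ j * coeff P j $ a $ b * x $ b)"
      by (simp add: meval_def matrix_vector_mult_def sum_distrib_right)
    also have "\<dots> = (\<Sum>j\<le>m. \<Sum>b\<in>UNIV. z ^ j * coeff P j $ a $ b * x $ b)"
      by (rule sum.swap)
    finally show ?thesis by (simp add: matrix_vector_mult_def sum_distrib_left mult.assoc)
  qed
  then show ?thesis by (simp add: vec_eq_iff)
qed

lemma meval_add: "meval m (P + Q) z = meval m P z + meval m Q z"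
  by (simp add: meval_def vec_eq_iff algebra_simps sum.distrib)

text \<open>The Euclidean norm of \<open>[1, z, ..., z^m]\<close>, called L in the overview.\<close>

definition power_norm :: "nat \<Rightarrow> complex \<Rightarrow> real" where
  "power_norm m z = L2_set (\<lambda>j. cmod (z ^ j)) {..m}"

lemma power_norm_pos: "power_norm m z > 0"
proof -
  have "cmod (z ^ 0) \<le> power_norm m z"
    unfolding power_norm_def by (rule member_le_L2_set) auto
  then show ?thesis by simp
qed

text \<open>Cauchy-Schwarz over the index \<open>j\<close>, between the powers of \<open>z\<close>
  and the coefficient norms.\<close>

lemma norm_meval_mult_vec_le:
  assumes "M \<in> {spectral_norm, frobenius_norm}"
  shows "norm (meval m D z *v x) \<le> power_norm m z * matpoly_norm M m D * norm x"
proof -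
  have "norm (meval m D z *v x) \<le> (\<Sum>j\<le>m. cmod (z ^ j) * (M (coeff D j) * norm x))"
    unfolding meval_mult_vec
    by (intro order_trans[OF norm_sum] sum_mono)
      (auto simp: norm_vector_scalar_mult intro!: mult_left_mono norm_mult_le_matrix_norm assms)
  also have "\<dots> = (\<Sum>j\<le>m. \<bar>cmod (z ^ j)\<bar> * \<bar>M (coeff D j)\<bar>) * norm x"
    using coeff_norm_facts(2)[OF assms] by (simp add: sum_distrib_right mult.assoc)
  also have "\<dots> \<le> power_norm m z * matpoly_norm M m D * norm x"
    unfolding power_norm_def matpoly_norm_def L2_set_def[symmetric]
    by (intro mult_right_mono L2_set_mult_ineq) auto
  finally show ?thesis .
qed

lemma coeff_sum_monom_atMost:
  "coeff (\<Sum>j\<le>m. monom (f j) j) k = (if k \<le> m then f k else 0)"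
  by (simp add: coeff_sum coeff_monom)

section \<open>Structured perturbations at real points\<close>

lemma conj_transpose_meval_of_real:
  assumes "\<And>j. j \<le> m \<Longrightarrow> conj_transpose (coeff P j) = \<sigma> *\<^sub>R coeff P j"
  shows "conj_transpose (meval m P (of_real r)) = \<sigma> *\<^sub>R meval m P (of_real r)"
proof -
  have "cnj (coeff P j $ b $ a) = \<sigma> *\<^sub>R coeff P j $ a $ b" if "j \<le> m" for j a b
    using assms[OF that] by (simp add: conj_transpose_def vec_eq_iff)
  then show ?thesis
    by (simp add: conj_transpose_def meval_def vec_eq_iff scaleR_sum_right)
qed

lemma structure_sign:
  assumes "S \<in> {hermitian_matpolys m, skew_hermitian_matpolys m}"
  obtains \<sigma> :: real where "\<sigma> \<in> {1, -1}"
    "S = {P \<in> matpolys m. \<forall>j\<le>m. conj_transpose (coeff P j) = \<sigma> *\<^sub>R coeff P j}"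
proof (cases "S = hermitian_matpolys m")
  case True
  then show thesis using that[of 1] by (simp add: hermitian_matpolys_def)
next
  case False
  then show thesis using that[of "-1"] assms by (simp add: skew_hermitian_matpolys_def)
qed

text \<open>The number \<open>s\<close> is the least residual over unit vectors. A single
  \<open>D\<close> serves both norms, because its coefficients are multiples of
  \<open>y y^H\<close>.\<close>

lemma minimal_structured_perturbation:
  fixes P :: "((complex^'n)^'n) poly"
  assumes S: "S \<in> {hermitian_matpolys m, skew_hermitian_matpolys m}" and P: "P \<in> S"
    and z: "z \<in> \<real>"
  obtains s y D where "norm y = 1" "D \<in> S" "meval m P z *v y + meval m D z *v y = 0"
    "\<forall>M\<in>{spectral_norm, frobenius_norm}. matpoly_norm M m D = s / power_norm m z"
    "\<forall>x. s * norm x \<le> norm (meval m P z *v x)"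
proof -
  obtain \<sigma> :: real where sg: "\<sigma> \<in> {1, -1}"
    and S_eq: "S = {P \<in> matpolys m. \<forall>j\<le>m. conj_transpose (coeff P j) = \<sigma> *\<^sub>R coeff P j}"
    using structure_sign[OF S] .
  obtain r where r: "z = of_real r" using z by (auto elim: Reals_cases)
  have "conj_transpose (meval m P z) = \<sigma> *\<^sub>R meval m P z"
    unfolding r using P S_eq by (intro conj_transpose_meval_of_real) auto
  from minimal_residual_eigenvector[OF sg this]
  obtain y and \<mu> :: complex where y: "norm y = 1" and eig: "meval m P z *v y = \<mu> *s y"
    and mu: "cnj \<mu> = \<sigma> * \<mu>" and min: "\<forall>v. cmod \<mu> * norm v \<le> norm (meval m P z *v v)" .
  define L where "L = power_norm m z"
  have L: "L > 0" by (simp add: L_def power_norm_pos)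
  have L2: "(\<Sum>j\<le>m. (r ^ j)\<^sup>2) = L\<^sup>2"
  proof -
    have "cmod (z ^ j) = \<bar>r ^ j\<bar>" for j
      by (simp add: r norm_power power_abs)
    then show ?thesis
      unfolding L_def power_norm_def L2_set_def by (simp del: power_abs add: sum_nonneg)
  qed
  \<comment> \<open>Among all solutions of \<open>\<Sum>j\<le>m. z^j * c j = - \<mu>\<close>, this
    one has least Euclidean norm (equality in Cauchy-Schwarz).\<close>
  define c where "c j = - (r ^ j / L\<^sup>2) * \<mu>" for j
  define D where "D = (\<Sum>j\<le>m. monom (outer_square (c j) y) j)"
  have cD: "coeff D j = (if j \<le> m then outer_square (c j) y else 0)" for j
    by (simp add: D_def coeff_sum_monom_atMost)
  have "degree D \<le> m" by (intro degree_le) (simp add: cD)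
  \<comment> \<open>Each \<open>c j\<close> is a real multiple of \<open>\<mu>\<close>, so it
    inherits \<open>cnj \<mu> = \<sigma> * \<mu>\<close>; here \<open>z\<close> being real is
    essential.\<close>
  moreover have "outer_square (cnj (c j)) y = \<sigma> *\<^sub>R outer_square (c j) y" for j
    using mu by (simp add: outer_square_def c_def vec_eq_iff) (simp add: scaleR_conv_of_real)
  ultimately have "D \<in> S"
    by (simp add: S_eq matpolys_def cD conj_transpose_outer_square)
  moreover have "meval m D z *v y = - \<mu> *s y"
  proof -
    have "meval m D z *v y = (\<Sum>j\<le>m. (z ^ j * c j) *s y)"
      unfolding meval_mult_vec
      by (intro sum.cong) (simp_all add: cD outer_square_mult_self y)
    also have "\<dots> = (\<Sum>j\<le>m. z ^ j * c j) *s y"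
      by (simp add: vec_eq_iff sum_distrib_right)
    also have "(\<Sum>j\<le>m. z ^ j * c j) = - of_real ((\<Sum>j\<le>m. (r ^ j)\<^sup>2) / L\<^sup>2) * \<mu>"
      by (simp add: c_def r power2_eq_square sum_negf sum_divide_distrib sum_distrib_right
          mult.assoc)
    also have "\<dots> = - \<mu>" using L by (simp add: L2)
    finally show ?thesis .
  qed
  then have "meval m P z *v y + meval m D z *v y = 0"
    by (simp add: eig vec_eq_iff)
  moreover have "matpoly_norm M m D = cmod \<mu> / power_norm m z"
    if M: "M \<in> {spectral_norm, frobenius_norm}" for M
  proof -
    have "(\<Sum>j\<le>m. (M (coeff D j))\<^sup>2) = (\<Sum>j\<le>m. (r ^ j)\<^sup>2 * (cmod \<mu> / L\<^sup>2)\<^sup>2)"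
    proof (intro sum.cong)
      fix j assume "j \<in> {..m}"
      then have "M (coeff D j) = cmod (c j)"
        by (simp add: cD matrix_norm_outer_square[OF M y])
      also have "\<dots> = \<bar>r ^ j\<bar> * (cmod \<mu> / L\<^sup>2)"
        by (simp add: c_def norm_mult norm_divide norm_power power_abs)
      finally show "(M (coeff D j))\<^sup>2 = (r ^ j)\<^sup>2 * (cmod \<mu> / L\<^sup>2)\<^sup>2"
        by (simp only: power_mult_distrib power2_abs)
    qed simp
    also have "\<dots> = (cmod \<mu> / L)\<^sup>2"
      unfolding sum_distrib_right[symmetric] L2 using L by (simp add: power2_eq_square)
    finally show ?thesis using L by (simp add: matpoly_norm_def L_def[symmetric])
  qed
  ultimately show thesis using that[of y D "cmod \<mu>"] y min by blast
qed

section \<open>Backward errors and pseudospectra\<close>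

lemma det_eq_0_iff_unit_kernel:
  fixes A :: "(complex^'n)^'n"
  shows "det A = 0 \<longleftrightarrow> (\<exists>x. norm x = 1 \<and> A *v x = 0)"
proof -
  have "det A = 0 \<longleftrightarrow> (\<exists>x. x \<noteq> 0 \<and> A *v x = 0)"
    using matrix_left_invertible_ker[of A] invertible_det_nz[of A] invertible_left_inverse[of A]
    by blast
  also have "\<dots> \<longleftrightarrow> (\<exists>x. norm x = 1 \<and> A *v x = 0)"
  proof
    assume "\<exists>x. x \<noteq> 0 \<and> A *v x = 0"
    then obtain x where x: "x \<noteq> 0" "A *v x = 0" by blast
    have "norm (complex_of_real (inverse (norm x)) *s x) = 1"
      using x(1) by (simp add: norm_vector_scalar_mult norm_inverse)
    moreover have "A *v (complex_of_real (inverse (norm x)) *s x) = 0"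
      by (simp only: vector_scalar_commute x(2)) (simp add: vec_eq_iff)
    ultimately show "\<exists>x. norm x = 1 \<and> A *v x = 0" by blast
  qed (metis norm_zero zero_neq_one)
  finally show ?thesis .
qed

text \<open>The lower bound holds for every perturbation, and \<open>D\<close> attains it inside
  \<open>S\<close>. Hence the values are the same for every class \<open>T\<close> containing
  \<open>S\<close>, structured or not.\<close>

lemma backward_error_pseudospectrum_eq:
  fixes P :: "((complex^'n)^'n) poly"
  assumes T: "S \<subseteq> T"
    and M: "M \<in> {spectral_norm, frobenius_norm}"
    and y: "norm y = 1" and D: "D \<in> S" "meval m P z *v y + meval m D z *v y = 0"
    and nD: "matpoly_norm M m D = s / power_norm m z"
    and min: "\<forall>x. s * norm x \<le> norm (meval m P z *v x)"
    and mP: "- P \<in> T"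
  shows "backward_error M m T z P = s / power_norm m z"
    and "z \<in> pseudospectrum M m T \<epsilon> P \<longleftrightarrow> s / power_norm m z \<le> \<epsilon>"
proof -
  have low: "s / power_norm m z \<le> matpoly_norm M m E"
    if "norm x = 1" "meval m P z *v x + meval m E z *v x = 0" for x E
  proof -
    have "s \<le> norm (meval m P z *v x)" using min[rule_format, of x] that by simp
    also have "\<dots> = norm (meval m E z *v x)"
      using that(2) by (simp add: add_eq_0_iff2)
    also have "\<dots> \<le> power_norm m z * matpoly_norm M m E"
      using norm_meval_mult_vec_le[OF M, of m E z x] that by simp
    finally show ?thesis using power_norm_pos[of m z] by (simp add: field_simps)
  qed
  \<comment> \<open>Thus \<open>- P\<close> is admissible for every \<open>x\<close>: no infimum is
    taken over an empty set.\<close>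
  have nul: "meval m P z *v x + meval m (- P) z *v x = 0" for x
    by (simp flip: matrix_vector_mult_add_rdistrib meval_add) (simp add: meval_def vec_eq_iff
        matrix_vector_mult_def)
  have ge: "s / power_norm m z \<le> backward_error_at M m T z x P" if "norm x = 1" for x
    unfolding backward_error_at_def
    using mP nul low[OF that] by (intro cInf_greatest) auto
  have "backward_error_at M m T z y P \<le> matpoly_norm M m D"
    unfolding backward_error_at_def
    using low[OF y] D T by (intro cInf_lower bdd_belowI[of _ "s / power_norm m z"]) auto
  then have eq: "backward_error_at M m T z y P = s / power_norm m z"
    using ge[OF y] nD by simp
  show "backward_error M m T z P = s / power_norm m z"
    unfolding backward_error_def
  proof (rule antisym)
    show "(INF x\<in>{x. norm x = 1}. backward_error_at M m T z x P) \<le> s / power_norm m z"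
      unfolding eq[symmetric] using y ge
      by (intro cINF_lower) (auto intro!: bdd_belowI[of _ "s / power_norm m z"])
    show "s / power_norm m z \<le> (INF x\<in>{x. norm x = 1}. backward_error_at M m T z x P)"
      using y ge by (intro cINF_greatest) auto
  qed
  have sp: "z \<in> spectrum m (P + E) \<longleftrightarrow>
      (\<exists>x. norm x = 1 \<and> meval m P z *v x + meval m E z *v x = 0)" for E
    by (simp add: spectrum_def det_eq_0_iff_unit_kernel meval_add matrix_vector_mult_add_rdistrib)
  show "z \<in> pseudospectrum M m T \<epsilon> P \<longleftrightarrow> s / power_norm m z \<le> \<epsilon>"
  proof
    assume "z \<in> pseudospectrum M m T \<epsilon> P"
    then show "s / power_norm m z \<le> \<epsilon>"
      using low by (auto simp: pseudospectrum_def sp intro: order_trans)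
  next
    assume "s / power_norm m z \<le> \<epsilon>"
    then show "z \<in> pseudospectrum M m T \<epsilon> P"
      using D T y nD by (auto simp: pseudospectrum_def sp)
  qed
qed

lemma uminus_in_structure:
  fixes P :: "((complex^'n)^'n) poly"
  assumes "S \<in> {hermitian_matpolys m, skew_hermitian_matpolys m}" and "P \<in> S"
  shows "- P \<in> S"
proof -
  have "conj_transpose (- A) = - conj_transpose A" for A :: "(complex^'n)^'n"
    by (simp add: conj_transpose_def vec_eq_iff)
  then show ?thesis
    using assms by (auto simp: hermitian_matpolys_def skew_hermitian_matpolys_def matpolys_def)
qed

theorem theorem5p3:
  fixes P :: "((complex^'n)^'n) poly"
    and S :: "((complex^'n)^'n) poly set"
    and M N :: "(complex^'n)^'n \<Rightarrow> real"
    and m :: nat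
    and \<epsilon> :: real
  assumes "m \<ge> 1"
    and "S \<in> {hermitian_matpolys m, skew_hermitian_matpolys m}"
    and "P \<in> S"
    and "regular_matpoly m P"
    and "\<epsilon> > 0"
    and "M \<in> {spectral_norm, frobenius_norm}"
    and "N \<in> {spectral_norm, frobenius_norm}"
    and "\<not> infinity_in_pseudospectrum N m (matpolys m) \<epsilon> P"
  shows "(\<forall>z\<in>\<real>. backward_error M m S z P = backward_error N m (matpolys m) z P) \<and>
    pseudospectrum M m S \<epsilon> P \<inter> \<real> = pseudospectrum N m (matpolys m) \<epsilon> P \<inter> \<real>"
proof -
  have sub: "S \<subseteq> matpolys m"
    using assms(2) by (auto simp: hermitian_matpolys_def skew_hermitian_matpolys_def)
  note mP = uminus_in_structure[OF assms(2,3)]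
  have "backward_error M m S z P = backward_error N m (matpolys m) z P \<and>
      (z \<in> pseudospectrum M m S \<epsilon> P \<longleftrightarrow> z \<in> pseudospectrum N m (matpolys m) \<epsilon> P)"
    if z: "z \<in> \<real>" for z
  proof -
    obtain s y D where "norm y = 1" "D \<in> S" "meval m P z *v y + meval m D z *v y = 0"
      and n: "\<forall>M\<in>{spectral_norm, frobenius_norm}. matpoly_norm M m D = s / power_norm m z"
      and "\<forall>x. s * norm x \<le> norm (meval m P z *v x)"
      using minimal_structured_perturbation[OF assms(2,3) z] .
    \<comment> \<open>The same \<open>D\<close> is used twice, for the class \<open>S\<close> with
      \<open>M\<close> and for all of \<open>matpolys m\<close> with \<open>N\<close>; both
      evaluations give \<open>s / power_norm m z\<close>.\<close>
    then show ?thesis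
      using backward_error_pseudospectrum_eq[OF order_refl assms(6) _ _ _ bspec[OF n assms(6)] _ mP]
        backward_error_pseudospectrum_eq[OF sub assms(7) _ _ _ bspec[OF n assms(7)] _ subsetD[OF sub mP]]
      by simp
  qed
  then show ?thesis by auto
qed

end
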